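(* Let $K=\mathbb{F}_q$ be a finite field with $q$ elements, let $s\geq 1$, and let $G=G(t_1,\ldots,t_s)\in K[t_1,\ldots,t_s]$ be a polynomial of total degree $d\geq 1$ such that $\deg_{t_i}(G)\leq q-2$ for $i=1,\ldots,s$. Let $Z_G=\{x\in (K^* )^s\mid G(x)=0\}$. If $d=k(q-2)+\ell$ with integers $k,\ell$ satisfying $1\leq \ell\leq q-2$ and $0\leq k\leq s-1$, then $$ |Z_G|\leq (q-1)^{s-k-1}\left((q-1)^{k+1}-(q-1)+\ell\right). $$
   Context: $K^*=K\setminus\{0\}$; $\deg_{t_i}(G)$ denotes the degree of $G$ in the variable $t_i$. *)

theory Defs
  imports "HOL-Library.Poly_Mapping" "HOL-Library.FuncSet" "HOL-Library.Cardinality"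
begin

text \<open>
  A monomial is a finitely supported exponent vector, and a multivariate polynomial over
  \<open>'a\<close> is a finitely supported map from monomials to coefficients; \<open>+\<close> and \<open>*\<close> on
  this type are those of the polynomial ring.  The variables are indexed by \<open>nat\<close>.
\<close>

type_synonym monomial = "nat \<Rightarrow>\<^sub>0 nat"
type_synonym 'a mvpoly = "monomial \<Rightarrow>\<^sub>0 'a"

text \<open>The ring \<open>'a[t\<^sub>1, \<dots>, t\<^sub>s]\<close>; \<open>t\<^sub>i\<close> is the variable with index \<open>i - 1\<close>.\<close>

definition poly_ring :: "nat \<Rightarrow> ('a::zero) mvpoly set"
  where "poly_ring s = {G. \<forall>m \<in> Poly_Mapping.keys G. Poly_Mapping.keys m \<subseteq> {..<s}}"

definition monom_degree :: "monomial \<Rightarrow> nat"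
  where "monom_degree m = (\<Sum>i \<in> Poly_Mapping.keys m. Poly_Mapping.lookup m i)"

text \<open>Both degrees take the value 0 on the zero polynomial.\<close>

definition total_degree :: "('a::zero) mvpoly \<Rightarrow> nat"
  where "total_degree G = Max (insert 0 (monom_degree ` Poly_Mapping.keys G))"

definition degree_in :: "nat \<Rightarrow> ('a::zero) mvpoly \<Rightarrow> nat"
  where "degree_in i G =
    Max (insert 0 ((\<lambda>m. Poly_Mapping.lookup m i) ` Poly_Mapping.keys G))"

definition eval_mvpoly :: "(nat \<Rightarrow> 'a) \<Rightarrow> ('a::comm_semiring_1) mvpoly \<Rightarrow> 'a"
  where "eval_mvpoly x G =
    (\<Sum>m \<in> Poly_Mapping.keys G. Poly_Mapping.lookup G m *
       (\<Prod>i \<in> Poly_Mapping.keys m. x i ^ Poly_Mapping.lookup m i))"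

text \<open>
  Points of \<open>(K\<^sup>*)\<^sup>s\<close> are extensional functions (equal to \<open>undefined\<close> outside
  \<open>{..<s}\<close>), so distinct functions are distinct points and cardinalities are correct.
\<close>

definition torus :: "nat \<Rightarrow> (nat \<Rightarrow> 'a::zero) set"
  where "torus s = {..<s} \<rightarrow>\<^sub>E (UNIV - {0})"

definition torus_zeros :: "nat \<Rightarrow> ('a::comm_semiring_1) mvpoly \<Rightarrow> (nat \<Rightarrow> 'a) set"
  where "torus_zeros s G = {x \<in> torus s. eval_mvpoly x G = 0}"

end

theory Submission
  imports Defs "HOL-Computational_Algebra.Polynomial"
begin

text \<open>
  Write \<open>n = q - 1\<close> for the number of elements of \<open>K\<^sup>*\<close>.  The bound is equivalent to saying that
  \<open>G\<close> has at least \<open>n^(s-k-1) * (n - l)\<close> nonzeros on the torus, and the proof bounds the nonzeros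
  from below in two independent steps.

  The algebraic step (\<open>ex_monomial_prod_le_card_nonzeros\<close>) finds a monomial \<open>t^a\<close> of \<open>G\<close> such that
  \<open>G\<close> has at least \<open>\<Prod>(n - a\<^sub>i)\<close> nonzeros on the grid.  The exponent \<open>a\<close> is a lexicographic leading
  exponent: single out one variable \<open>t\<close>, let \<open>r\<close> be the degree of \<open>G\<close> in \<open>t\<close>, and consider the
  coefficient of \<open>t^r\<close>, a polynomial in the remaining variables.  Wherever this coefficient does not
  vanish, \<open>G\<close> becomes a univariate polynomial of degree \<open>r\<close> in \<open>t\<close>, which has at most \<open>r\<close> roots and
  therefore at least \<open>n - r\<close> nonzeros in \<open>K\<^sup>*\<close>.

  The combinatorial step (\<open>prod_Suc_ge_of_sum_ge\<close>) minimises \<open>\<Prod>(n - a\<^sub>i)\<close> subject to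
  \<open>0 \<le> a\<^sub>i \<le> n - 1\<close> and \<open>\<Sum>a\<^sub>i \<le> k(n - 1) + l\<close>.  For a fixed sum a product is smallest when its
  factors are as unequal as possible, that is, when \<open>k\<close> of the exponents equal \<open>n - 1\<close>, one equals
  \<open>l\<close> and the remaining \<open>s - k - 1\<close> vanish; the product is then \<open>n^(s-k-1) * (n - l)\<close>.
\<close>

section \<open>Nonzeros of a polynomial on a grid\<close>

lemma card_nonroots_ge:
  fixes p :: "'a::idom poly"
  assumes "finite A" "p \<noteq> 0" "degree p \<le> r"
  shows "card A - r \<le> card {a \<in> A. poly p a \<noteq> 0}"
proof -
  have "{a \<in> A. poly p a \<noteq> 0} = A - {a. poly p a = 0}"
    by auto
  moreover have "card {a. poly p a = 0} \<le> r"
    using card_poly_roots_bound[OF \<open>p \<noteq> 0\<close>] assms(3) by simp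
  moreover have "card A - card {a. poly p a = 0} \<le> card (A - {a. poly p a = 0})"
    by (rule diff_card_le_card_Diff) (simp add: poly_roots_finite assms(2))
  ultimately show ?thesis
    by simp
qed

text \<open>
  A polynomial is given here by a finite set \<open>M\<close> of labels, each with a coefficient \<open>c m\<close> and an
  exponent vector \<open>e m\<close>, of which only the restriction to the variables in \<open>I\<close> matters.  With this
  encoding the leading coefficient in a variable \<open>j\<close> is obtained by just shrinking \<open>M\<close> and \<open>I\<close>:
  labels that agree at \<open>j\<close> and have different exponents on \<open>insert j I\<close> still have different
  exponents on \<open>I\<close>.  The truncated subtraction makes a factor with \<open>e m i \<ge> card A\<close> harmless.
\<close>

lemma ex_monomial_prod_le_card_nonzeros:
  fixes c :: "'m \<Rightarrow> 'a::idom" and e :: "'m \<Rightarrow> 'i \<Rightarrow> nat"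
  assumes "finite I" "finite A" "finite M" "M \<noteq> {}"
    and "inj_on (\<lambda>m. restrict (e m) I) M"
    and "\<And>m. m \<in> M \<Longrightarrow> c m \<noteq> 0"
  shows "\<exists>m\<in>M. (\<Prod>i\<in>I. card A - e m i)
    \<le> card {x \<in> I \<rightarrow>\<^sub>E A. (\<Sum>m\<in>M. c m * (\<Prod>i\<in>I. x i ^ e m i)) \<noteq> 0}"
  using assms(1,3-6)
proof (induction I arbitrary: M rule: finite_induct)
  case empty
  then have "m = m'" if "m \<in> M" "m' \<in> M" for m m'
    using that by (auto simp: inj_on_def restrict_def)
  with empty.prems(2) obtain m where "M = {m}"
    by blast
  with empty show ?case
    by simp
next
  case (insert j I)
  define r where "r = Max ((\<lambda>m. e m j) ` M)"
  define L where "L = {m \<in> M. e m j = r}"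
  have le_r: "e m j \<le> r" if "m \<in> M" for m
    unfolding r_def using that insert.prems by simp
  have "r \<in> (\<lambda>m. e m j) ` M"
    unfolding r_def using insert.prems by (intro Max_in) auto
  then have "L \<noteq> {}"
    by (auto simp: L_def)
  moreover have "finite L" "L \<subseteq> M"
    using insert.prems by (auto simp: L_def)
  moreover have "inj_on (\<lambda>m. restrict (e m) I) L"
  proof (rule inj_onI)
    fix m m' assume mm: "m \<in> L" "m' \<in> L" "restrict (e m) I = restrict (e m') I"
    then have "restrict (e m) (insert j I) = restrict (e m') (insert j I)"
      by (auto simp: L_def restrict_def fun_eq_iff) metis
    then show "m = m'"
      using mm by (intro inj_onD[OF insert.prems(3)]) (auto simp: L_def)
  qed
  ultimately obtain m where m: "m \<in> L" and
    IH: "(\<Prod>i\<in>I. card A - e m i)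
      \<le> card {x \<in> I \<rightarrow>\<^sub>E A. (\<Sum>m\<in>L. c m * (\<Prod>i\<in>I. x i ^ e m i)) \<noteq> 0}"
    using insert.IH[of L] insert.prems(4) by blast
  define B where "B = {x \<in> I \<rightarrow>\<^sub>E A. (\<Sum>m\<in>L. c m * (\<Prod>i\<in>I. x i ^ e m i)) \<noteq> 0}"
  define C where
    "C = {x \<in> insert j I \<rightarrow>\<^sub>E A. (\<Sum>m\<in>M. c m * (\<Prod>i\<in>insert j I. x i ^ e m i)) \<noteq> 0}"
  define P where "P x = (\<Sum>m\<in>M. monom (c m * (\<Prod>i\<in>I. x i ^ e m i)) (e m j))" for x
  have poly_P: "poly (P x) a = (\<Sum>m\<in>M. c m * (\<Prod>i\<in>insert j I. (x(j := a)) i ^ e m i))" for x a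
  proof -
    have "(\<Prod>i\<in>I. (x(j := a)) i ^ e m i) = (\<Prod>i\<in>I. x i ^ e m i)" for m
      using insert.hyps by (intro prod.cong) auto
    then show ?thesis
      using insert.hyps by (simp add: P_def poly_sum poly_monom mult_ac)
  qed
  have fiber: "card A - r \<le> card {a \<in> A. poly (P x) a \<noteq> 0}" if "x \<in> B" for x
  proof (rule card_nonroots_ge[OF \<open>finite A\<close>])
    have "coeff (P x) r = (\<Sum>m\<in>L. c m * (\<Prod>i\<in>I. x i ^ e m i))"
      unfolding P_def L_def coeff_sum using insert.prems(1)
      by (auto simp: sum.inter_filter intro!: sum.cong)
    with that show "P x \<noteq> 0"
      by (auto simp: B_def)
    show "degree (P x) \<le> r"
      unfolding P_def by (intro degree_sum_le insert.prems(1)) (meson degree_monom_le le_r order_trans)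
  qed
  have "finite B" "finite C"
    using insert.hyps \<open>finite A\<close> by (auto simp: B_def C_def intro!: finite_PiE)
  have "inj_on (\<lambda>(x, a). x(j := a)) (Sigma B (\<lambda>x. {a \<in> A. poly (P x) a \<noteq> 0}))"
  proof (rule inj_onI, clarify)
    fix x a y b assume "x \<in> B" "y \<in> B" and eq: "x(j := a) = y(j := b)"
    then have "x j = y j"
      using insert.hyps by (auto simp: B_def PiE_def extensional_def)
    with eq show "x = y \<and> a = b"
      by (metis fun_upd_same fun_upd_triv fun_upd_upd)
  qed
  moreover have "(\<lambda>(x, a). x(j := a)) ` Sigma B (\<lambda>x. {a \<in> A. poly (P x) a \<noteq> 0}) \<subseteq> C"
    unfolding C_def poly_P by (auto simp: B_def intro!: fun_upd_in_PiE PiE_fun_upd)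
  ultimately have "card (Sigma B (\<lambda>x. {a \<in> A. poly (P x) a \<noteq> 0})) \<le> card C"
    using \<open>finite C\<close> by (rule card_inj_on_le)
  also have "card (Sigma B (\<lambda>x. {a \<in> A. poly (P x) a \<noteq> 0}))
      = (\<Sum>x\<in>B. card {a \<in> A. poly (P x) a \<noteq> 0})"
    using \<open>finite B\<close> \<open>finite A\<close> by simp
  finally have "(\<Sum>x\<in>B. card {a \<in> A. poly (P x) a \<noteq> 0}) \<le> card C" .
  moreover have "card B * (card A - r) \<le> (\<Sum>x\<in>B. card {a \<in> A. poly (P x) a \<noteq> 0})"
    using sum_bounded_below[of B "card A - r"] fiber by simp
  moreover have "(\<Prod>i\<in>insert j I. card A - e m i) \<le> card B * (card A - r)"
    using insert.hyps IH m by (simp add: B_def L_def mult.commute)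
  ultimately show ?case
    using m unfolding C_def L_def by (intro bexI[of _ m]) auto
qed

section \<open>Products of bounded factors with large sum\<close>

text \<open>
  Among factors in \<open>{1..Suc N}\<close> of prescribed sum, the product is smallest when at most one factor
  is strictly between the extremes.  Splitting off one factor \<open>Suc (b j)\<close>, the remaining lower bound
  \<open>t * N + w - b j\<close> is brought back into the form \<open>t' * N + w'\<close> with \<open>w' \<le> N\<close>, borrowing one \<open>N\<close>
  if \<open>b j > w\<close>; the claim then reduces to a two-factor exchange inequality, which amounts to
  \<open>(w - b j) * b j \<ge> 0\<close> without and to \<open>(b j - w) * (N - b j) \<ge> 0\<close> with borrowing.
\<close>

lemma prod_Suc_ge_of_sum_ge:
  fixes b :: "'i \<Rightarrow> nat"
  assumes "finite I" "\<And>i. i \<in> I \<Longrightarrow> b i \<le> N" "w \<le> N" "t * N + w \<le> (\<Sum>i\<in>I. b i)"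
  shows "Suc N ^ t * Suc w \<le> (\<Prod>i\<in>I. Suc (b i))"
  using assms
proof (induction I arbitrary: t w rule: finite_induct)
  case empty
  then show ?case
    by auto
next
  case (insert j I)
  have bj: "b j \<le> N" and bI: "\<And>i. i \<in> I \<Longrightarrow> b i \<le> N"
    using insert.prems by auto
  have sum: "t * N + w \<le> b j + (\<Sum>i\<in>I. b i)"
    using insert.prems(3) insert.hyps by simp
  have prod: "(\<Prod>i\<in>insert j I. Suc (b i)) = Suc (b j) * (\<Prod>i\<in>I. Suc (b i))"
    using insert.hyps by simp
  consider (small) "b j \<le> w" | (last) "w < b j" "t = 0" | (borrow) t' where "w < b j" "t = Suc t'"
    by (metis not_le not0_implies_Suc)
  then show ?case
  proof cases
    case small
    then obtain v where v: "w = b j + v"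
      using le_Suc_ex by blast
    have "Suc N ^ t * Suc v \<le> (\<Prod>i\<in>I. Suc (b i))"
      using insert.IH[of v t] bI sum v insert.prems(2) by simp
    then have "Suc (b j) * (Suc N ^ t * Suc v) \<le> (\<Prod>i\<in>insert j I. Suc (b i))"
      unfolding prod by (rule mult_le_mono2)
    moreover have "Suc w \<le> Suc (b j) * Suc v"
      by (simp add: v)
    then have "Suc N ^ t * Suc w \<le> Suc N ^ t * (Suc (b j) * Suc v)"
      by (rule mult_le_mono2)
    ultimately show ?thesis
      by (simp only: mult.left_commute)
  next
    case last
    have "1 \<le> (\<Prod>i\<in>I. Suc (b i))"
      by (intro prod_ge_1) simp
    then have "Suc (b j) * 1 \<le> Suc (b j) * (\<Prod>i\<in>I. Suc (b i))"
      by (rule mult_le_mono2)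
    with last show ?thesis
      unfolding prod by simp
  next
    case borrow
    obtain u where u: "b j = w + u"
      using borrow(1) less_imp_le le_Suc_ex by blast
    obtain v where v: "N = b j + v"
      using bj le_Suc_ex by blast
    have "Suc N ^ t' * Suc (w + v) \<le> (\<Prod>i\<in>I. Suc (b i))"
      using insert.IH[of "w + v" t'] bI sum borrow(2) u v by simp
    then have "Suc (b j) * (Suc N ^ t' * Suc (w + v)) \<le> (\<Prod>i\<in>insert j I. Suc (b i))"
      unfolding prod by (rule mult_le_mono2)
    moreover have "Suc N * Suc w \<le> Suc (b j) * Suc (w + v)"
      by (simp add: u v algebra_simps)
    then have "Suc N ^ t' * (Suc N * Suc w) \<le> Suc N ^ t' * (Suc (b j) * Suc (w + v))"
      by (rule mult_le_mono2)
    ultimately show ?thesis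
      using borrow(2) by (simp only: power_Suc mult_ac)
  qed
qed

text \<open>
  The exponents \<open>a i\<close> enter through their complements \<open>b i = n - 1 - a i\<close>, whose sum is at least
  \<open>(card I - k - 1) * (n - 1) + (n - 1 - l)\<close>.
\<close>

lemma prod_diff_ge_of_sum_le:
  fixes a :: "'i \<Rightarrow> nat"
  assumes "finite I" "\<And>i. i \<in> I \<Longrightarrow> a i < n" "(\<Sum>i\<in>I. a i) \<le> k * (n - 1) + l"
    and "k < card I" "l < n"
  shows "n ^ (card I - k - 1) * (n - l) \<le> (\<Prod>i\<in>I. n - a i)"
proof -
  obtain N where n: "n = Suc N"
    using \<open>l < n\<close> by (cases n) auto
  obtain t where t: "card I = k + t + 1"
    using \<open>k < card I\<close> less_imp_Suc_add by fastforce
  have "(\<Sum>i\<in>I. N - a i) + (\<Sum>i\<in>I. a i) = (\<Sum>i\<in>I. N)"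
    unfolding sum.distrib[symmetric] using assms(2) n by (intro sum.cong) force+
  then have "(\<Sum>i\<in>I. N - a i) + (\<Sum>i\<in>I. a i) = k * N + t * N + N"
    by (simp add: t algebra_simps)
  then have "t * N + (N - l) \<le> (\<Sum>i\<in>I. N - a i)"
    using assms(3,5) n by simp
  then have "Suc N ^ t * Suc (N - l) \<le> (\<Prod>i\<in>I. Suc (N - a i))"
    using assms(1) by (intro prod_Suc_ge_of_sum_ge) auto
  also have "\<dots> = (\<Prod>i\<in>I. n - a i)"
    using assms(2) n by (intro prod.cong) (auto simp: Suc_diff_le less_Suc_eq_le)
  finally show ?thesis
    using t n assms(5) by (simp add: Suc_diff_le)
qed

section \<open>Zeros on the torus\<close>

lemma eval_mvpoly_poly_ring:
  assumes "G \<in> poly_ring s"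
  shows "eval_mvpoly x G = (\<Sum>m\<in>Poly_Mapping.keys G. Poly_Mapping.lookup G m *
    (\<Prod>i<s. x i ^ Poly_Mapping.lookup m i))"
  unfolding eval_mvpoly_def using assms
  by (intro sum.cong refl arg_cong2[where f = "(*)"] prod.mono_neutral_left)
    (auto simp: poly_ring_def in_keys_iff)

lemma monom_degree_eq_sum:
  assumes "G \<in> poly_ring s" "m \<in> Poly_Mapping.keys G"
  shows "monom_degree m = (\<Sum>i<s. Poly_Mapping.lookup m i)"
  unfolding monom_degree_def using assms
  by (intro sum.mono_neutral_left) (auto simp: poly_ring_def in_keys_iff)

lemma inj_on_restrict_lookup:
  assumes "G \<in> poly_ring s"
  shows "inj_on (\<lambda>m. restrict (Poly_Mapping.lookup m) {..<s}) (Poly_Mapping.keys G)"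
proof (rule inj_onI, rule poly_mapping_eqI)
  fix m m' i
  assume m: "m \<in> Poly_Mapping.keys G" "m' \<in> Poly_Mapping.keys G"
    and eq: "restrict (Poly_Mapping.lookup m) {..<s} = restrict (Poly_Mapping.lookup m') {..<s}"
  show "Poly_Mapping.lookup m i = Poly_Mapping.lookup m' i"
  proof (cases "i < s")
    case True
    then show ?thesis
      using fun_cong[OF eq, of i] by simp
  next
    case False
    then have "i \<notin> Poly_Mapping.keys m" "i \<notin> Poly_Mapping.keys m'"
      using assms m by (auto simp: poly_ring_def)
    then show ?thesis
      by (simp add: in_keys_iff)
  qed
qed

theorem theorem3p4:
  fixes G :: "('a::{field, finite}) mvpoly"
    and q s d k l :: nat
  assumes "q = CARD('a)"
    and "s \<ge> 1"
    and "G \<in> poly_ring s"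
    and "total_degree G = d"
    and "d \<ge> 1"
    and "\<And>i. i < s \<Longrightarrow> degree_in i G \<le> q - 2"
    and "d = k * (q - 2) + l"
    and "1 \<le> l" and "l \<le> q - 2"
    and "k \<le> s - 1"
  shows "int (card (torus_zeros s G))
    \<le> (int q - 1) ^ (s - k - 1) * ((int q - 1) ^ (k + 1) - (int q - 1) + int l)"
proof -
  define n where "n = q - 1"
  have n: "q - 2 = n - 1" "l < n" "int q - 1 = int n"
    using assms(8,9) by (auto simp: n_def)
  define NZ where "NZ = {x \<in> torus s. eval_mvpoly x G \<noteq> 0}"
  have cardA: "card (UNIV - {0::'a}) = n"
    by (simp add: n_def assms(1))
  have ne: "Poly_Mapping.keys G \<noteq> {}"
    using assms(4,5) by (auto simp: total_degree_def)
  obtain m where m: "m \<in> Poly_Mapping.keys G"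
    and "(\<Prod>i<s. card (UNIV - {0::'a}) - Poly_Mapping.lookup m i) \<le> card NZ"
    using ex_monomial_prod_le_card_nonzeros[of "{..<s}" "UNIV - {0::'a}" "Poly_Mapping.keys G"
        Poly_Mapping.lookup "Poly_Mapping.lookup G"] ne inj_on_restrict_lookup[OF assms(3)]
    by (auto simp: NZ_def torus_def eval_mvpoly_poly_ring[OF assms(3)] in_keys_iff)
  then have NZ: "(\<Prod>i<s. n - Poly_Mapping.lookup m i) \<le> card NZ"
    by (simp only: cardA)
  have "n ^ (card {..<s} - k - 1) * (n - l) \<le> (\<Prod>i<s. n - Poly_Mapping.lookup m i)"
  proof (rule prod_diff_ge_of_sum_le)
    fix i assume "i \<in> {..<s}"
    then have "Poly_Mapping.lookup m i \<le> degree_in i G"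
      unfolding degree_in_def using m by (intro Max_ge) auto
    with \<open>i \<in> {..<s}\<close> show "Poly_Mapping.lookup m i < n"
      using assms(6)[of i] n by simp
  next
    have "monom_degree m \<le> total_degree G"
      unfolding total_degree_def using m by (intro Max_ge) auto
    then show "(\<Sum>i<s. Poly_Mapping.lookup m i) \<le> k * (n - 1) + l"
      using assms(4,7) n monom_degree_eq_sum[OF assms(3) m] by simp
  qed (use assms(2,10) n in auto)
  with NZ have "n ^ (s - k - 1) * (n - l) \<le> card NZ"
    by simp
  then have NZ_int: "int n ^ (s - k - 1) * (int n - int l) \<le> int (card NZ)"
    using n(2) by (simp flip: of_nat_power of_nat_mult of_nat_diff)
  have "finite (torus s :: (nat \<Rightarrow> 'a) set)"
    by (auto simp: torus_def intro!: finite_PiE)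
  then have "card (torus_zeros s G) + card NZ = card (torus s :: (nat \<Rightarrow> 'a) set)"
    by (subst card_Un_disjoint[symmetric])
      (auto simp: NZ_def torus_zeros_def intro!: arg_cong[where f = card])
  also have "\<dots> = n ^ s"
    by (simp add: torus_def card_PiE cardA)
  also have "\<dots> = n ^ (s - k - 1) * n ^ (k + 1)"
    using assms(2,10) by (subst power_add[symmetric]) simp
  finally have "int (card (torus_zeros s G)) + int (card NZ)
      = int n ^ (s - k - 1) * int n ^ (k + 1)"
    by (simp flip: of_nat_power of_nat_mult of_nat_add)
  with NZ_int show ?thesis
    unfolding n(3) by (simp add: algebra_simps)
qed

end
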